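(* Let $\alpha^+,\lambda^+,\alpha^-,\lambda^->0$ and let $f$ be the density of the bilateral Gamma distribution with parameters $(\alpha^+,\lambda^+;\alpha^-,\lambda^-)$. Then $$f(x)\sim C_3\,x^{\alpha^+-1}e^{-\lambda^+x}\quad\text{as }x\to\infty,\qquad f(x)\sim C_4\,|x|^{\alpha^--1}e^{-\lambda^-|x|}\quad\text{as }x\to-\infty,$$ where the constants $C_3,C_4>0$ are given by $$C_3=\frac{(\lambda^+)^{\alpha^+}(\lambda^-)^{\alpha^-}}{(\lambda^++\lambda^-)^{\alpha^-}\Gamma(\alpha^+)},\qquad C_4=\frac{(\lambda^+)^{\alpha^+}(\lambda^-)^{\alpha^-}}{(\lambda^++\lambda^-)^{\alpha^+}\Gamma(\alpha^-)}.$$ Consequently, $$\lim_{x\to\infty}\frac{\ln f(x)}{x}=-\lambda^+\qquad\text{and}\qquad\lim_{x\to-\infty}\frac{\ln f(x)}{x}=\lambda^-.$$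
   Context: For $\alpha,\lambda>0$, $\Gamma(\alpha,\lambda)$ denotes the Gamma distribution with density $\frac{\lambda^\alpha}{\Gamma(\alpha)}x^{\alpha-1}e^{-\lambda x}$ on $(0,\infty)$. The bilateral Gamma distribution with parameters $(\alpha^+,\lambda^+;\alpha^-,\lambda^-)$, all $>0$, is the distribution of $X-Y$ where $X\sim\Gamma(\alpha^+,\lambda^+)$ and $Y\sim\Gamma(\alpha^-,\lambda^-)$ are independent. Its density $f(x)=f(x;\alpha^+,\lambda^+,\alpha^-,\lambda^-)$ is given for $x>0$ by $$f(x)=\frac{(\lambda^+)^{\alpha^+}(\lambda^-)^{\alpha^-}}{(\lambda^++\lambda^-)^{\alpha^-}\Gamma(\alpha^+)\Gamma(\alpha^-)}e^{-\lambda^+x}\int_0^\infty v^{\alpha^--1}\Big(x+\frac{v}{\lambda^++\lambda^-}\Big)^{\alpha^+-1}e^{-v}\,dv,$$ and for $x<0$ by $f(x;\alpha^+,\lambda^+,\alpha^-,\lambda^-)=f(-x;\alpha^-,\lambda^-,\alpha^+,\lambda^+)$. The notation $g\sim h$ means that $g(x)/h(x)\to1$ in the indicated limit. *)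

theory Defs
  imports "HOL-Probability.Probability" "HOL-Library.Landau_Symbols"
begin

definition gamma_density :: "real \<Rightarrow> real \<Rightarrow> real \<Rightarrow> real" where
  "gamma_density \<alpha> l x =
     (if x > 0 then l powr \<alpha> / Gamma \<alpha> * x powr (\<alpha> - 1) * exp (- l * x) else 0)"

definition bilateral_gamma_density_pos :: "real \<Rightarrow> real \<Rightarrow> real \<Rightarrow> real \<Rightarrow> real \<Rightarrow> real" where
  "bilateral_gamma_density_pos \<alpha>p lp \<alpha>m lm x =
     lp powr \<alpha>p * lm powr \<alpha>m / ((lp + lm) powr \<alpha>m * Gamma \<alpha>p * Gamma \<alpha>m) * exp (- lp * x)
     * (LBINT v:{0<..}. v powr (\<alpha>m - 1) * (x + v / (lp + lm)) powr (\<alpha>p - 1) * exp (- v))"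

text \<open>
  The arguments \<open>\<alpha>p lp \<alpha>m lm\<close> stand for \<open>\<alpha>\<^sup>+, \<lambda>\<^sup>+, \<alpha>\<^sup>-, \<lambda>\<^sup>-\<close>. That this version of the density
  belongs to the law of \<open>X - Y\<close> for independent Gamma variables is proved below in
  \<open>distributed_bilateral_gamma\<close>. The value at \<open>0\<close> is an arbitrary choice
  (the density may have a pole there) and affects neither the distribution nor the tails.
\<close>

definition bilateral_gamma_density :: "real \<Rightarrow> real \<Rightarrow> real \<Rightarrow> real \<Rightarrow> real \<Rightarrow> real" where
  "bilateral_gamma_density \<alpha>p lp \<alpha>m lm x =
     (if x > 0 then bilateral_gamma_density_pos \<alpha>p lp \<alpha>m lm x
      else if x < 0 then bilateral_gamma_density_pos \<alpha>m lm \<alpha>p lp (- x)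
      else 0)"

lemma gamma_density_measurable [measurable]: "gamma_density \<alpha> l \<in> borel_measurable borel"
  unfolding gamma_density_def [abs_def] by measurable

lemma gamma_density_nonneg: "\<alpha> > 0 \<Longrightarrow> gamma_density \<alpha> l x \<ge> 0"
  by (auto simp: gamma_density_def intro!: mult_nonneg_nonneg divide_nonneg_nonneg Gamma_real_pos less_imp_le)

lemma bilateral_gamma_density_pos_measurable [measurable]:
  "bilateral_gamma_density_pos \<alpha>p lp \<alpha>m lm \<in> borel_measurable borel"
  unfolding bilateral_gamma_density_pos_def [abs_def] set_lebesgue_integral_def by measurable

lemma bilateral_gamma_density_measurable [measurable]:
  "bilateral_gamma_density \<alpha>p lp \<alpha>m lm \<in> borel_measurable borel"
  unfolding bilateral_gamma_density_def [abs_def] by measurable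

lemma prob_space_gamma_density:
  assumes "\<alpha> > 0" "l > 0"
  shows "prob_space (density lborel (\<lambda>x. ennreal (gamma_density \<alpha> l x)))"
proof
  have I: "((\<lambda>t. (t powr (\<alpha> - 1) / exp t) / Gamma \<alpha>) has_integral Gamma \<alpha> / Gamma \<alpha>) {0..}"
    by (intro has_integral_divide Gamma_integral_real assms)
  have G: "Gamma \<alpha> > 0" using assms by (simp add: Gamma_real_pos)
  have "(\<integral>\<^sup>+x. ennreal (gamma_density \<alpha> l x) \<partial>lborel)
      = ennreal (1 / l) * (\<integral>\<^sup>+x. ennreal (gamma_density \<alpha> l (x / l)) \<partial>lborel)"
    using assms by (subst nn_integral_real_affine[where c = "1 / l" and t = 0]) auto
  also have "\<dots> = (\<integral>\<^sup>+x. ennreal (1 / l * gamma_density \<alpha> l (x / l)) \<partial>lborel)"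
    using assms by (subst nn_integral_cmult [symmetric]) (auto simp: ennreal_mult' [symmetric] intro!: nn_integral_cong)
  also have "\<dots> = (\<integral>\<^sup>+x. ennreal ((x powr (\<alpha> - 1) / exp x) / Gamma \<alpha>) * indicator {0..} x \<partial>lborel)"
  proof (intro nn_integral_cong_AE)
    have "AE x in lborel. x \<noteq> (0::real)" by (rule AE_lborel_singleton)
    then show "AE x in lborel. ennreal (1 / l * gamma_density \<alpha> l (x / l)) =
        ennreal ((x powr (\<alpha> - 1) / exp x) / Gamma \<alpha>) * indicator {0..} x"
    proof eventually_elim
      case (elim x)
      have *: "l powr \<alpha> = l * l powr (\<alpha> - 1)"
        using assms by (simp add: powr_diff)
      show ?case
        using elim assms
        by (auto simp: gamma_density_def * powr_divide exp_minus indicator_def field_simps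
            zero_less_divide_iff)
    qed
  qed
  also have "\<dots> = ennreal (Gamma \<alpha> / Gamma \<alpha>)"
    using G by (intro nn_integral_has_integral_lebesgue' I) auto
  also have "\<dots> = 1" using G by simp
  finally show "emeasure (density lborel (\<lambda>x. ennreal (gamma_density \<alpha> l x)))
      (space (density lborel (\<lambda>x. ennreal (gamma_density \<alpha> l x)))) = 1"
    by (simp add: emeasure_density)
qed

lemma bilateral_gamma_density_pos_eq_nn_integral:
  assumes pos: "\<alpha>p > 0" "lp > 0" "\<alpha>m > 0" "lm > 0" and x: "x > 0"
    and fin: "(\<integral>\<^sup>+y. ennreal (gamma_density \<alpha>p lp (x + y)) * ennreal (gamma_density \<alpha>m lm y) \<partial>lborel) < \<infinity>"
  shows "(\<integral>\<^sup>+y. ennreal (gamma_density \<alpha>p lp (x + y)) * ennreal (gamma_density \<alpha>m lm y) \<partial>lborel)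
    = ennreal (bilateral_gamma_density_pos \<alpha>p lp \<alpha>m lm x)"
    (is "?L = _")
proof -
  define s where "s = lp + lm"
  define C where "C = lp powr \<alpha>p * lm powr \<alpha>m / (s powr \<alpha>m * Gamma \<alpha>p * Gamma \<alpha>m) * exp (- lp * x)"
  define k where "k = (\<lambda>v. indicator {0<..} v *\<^sub>R (v powr (\<alpha>m - 1) * (x + v / s) powr (\<alpha>p - 1) * exp (- v)))"
  have s: "s > 0" using pos by (simp add: s_def)
  have C: "C > 0" using pos s by (simp add: C_def Gamma_real_pos)
  have [measurable]: "k \<in> borel_measurable borel" unfolding k_def by measurable
  have k0: "k v \<ge> 0" for v by (simp add: k_def indicator_def)
  have pt: "1 / s * (gamma_density \<alpha>p lp (x + v / s) * gamma_density \<alpha>m lm (v / s)) = C * k v" for v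
  proof (cases "v > 0")
    case True
    have e: "exp (- lp * (x + v / s)) * exp (- lm * (v / s)) = exp (- lp * x) * exp (- v)"
    proof -
      have "lp * (v / s) + lm * (v / s) = (lp + lm) * (v / s)" by (rule distrib_right [symmetric])
      also have "\<dots> = v" using s by (simp add: s_def)
      finally show ?thesis by (simp add: exp_add [symmetric] algebra_simps)
    qed
    have p: "1 / s * (v / s) powr (\<alpha>m - 1) = v powr (\<alpha>m - 1) / s powr \<alpha>m"
      using s True by (simp add: powr_divide powr_diff field_simps)
    have xv: "x + v / s > 0" "v / s > 0" using x True s by (auto intro: add_pos_pos)
    have "1 / s * (gamma_density \<alpha>p lp (x + v / s) * gamma_density \<alpha>m lm (v / s))
      = lp powr \<alpha>p / Gamma \<alpha>p * (lm powr \<alpha>m / Gamma \<alpha>m) * (x + v / s) powr (\<alpha>p - 1)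
        * (1 / s * (v / s) powr (\<alpha>m - 1))
        * (exp (- lp * (x + v / s)) * exp (- lm * (v / s)))"
      unfolding gamma_density_def using xv by (simp only: if_True ac_simps)
    also have "\<dots> = C * k v"
      unfolding e p using True by (simp add: C_def k_def mult_ac)
    finally show ?thesis .
  next
    case False
    then show ?thesis using s by (auto simp: gamma_density_def k_def zero_less_divide_iff)
  qed
  have "?L = (\<integral>\<^sup>+y. ennreal (gamma_density \<alpha>p lp (x + y) * gamma_density \<alpha>m lm y) \<partial>lborel)"
    using pos by (auto simp: ennreal_mult' gamma_density_nonneg intro!: nn_integral_cong)
  also have "\<dots> = ennreal (1 / s) *
      (\<integral>\<^sup>+v. ennreal (gamma_density \<alpha>p lp (x + v / s) * gamma_density \<alpha>m lm (v / s)) \<partial>lborel)"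
    using s by (subst nn_integral_real_affine[where c = "1 / s" and t = 0]) auto
  also have "\<dots> = (\<integral>\<^sup>+v. ennreal (1 / s * (gamma_density \<alpha>p lp (x + v / s) * gamma_density \<alpha>m lm (v / s))) \<partial>lborel)"
    using s by (subst nn_integral_cmult [symmetric]) (auto simp: ennreal_mult' [symmetric] intro!: nn_integral_cong)
  also have "\<dots> = (\<integral>\<^sup>+v. ennreal (C * k v) \<partial>lborel)" by (simp only: pt)
  finally have L: "?L = (\<integral>\<^sup>+v. ennreal (C * k v) \<partial>lborel)" .
  have "integrable lborel (\<lambda>v. C * k v)"
    using fin C k0 unfolding L by (intro integrableI_nonneg) auto
  then have "?L = ennreal (\<integral>v. C * k v \<partial>lborel)"
    unfolding L using C k0 by (intro nn_integral_eq_integral) auto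
  also have "(\<integral>v. C * k v \<partial>lborel) = bilateral_gamma_density_pos \<alpha>p lp \<alpha>m lm x"
    by (simp add: bilateral_gamma_density_pos_def C_def k_def s_def set_lebesgue_integral_def)
  finally show ?thesis .
qed

lemma (in prob_space) distributed_bilateral_gamma:
  assumes pos: "\<alpha>p > 0" "lp > 0" "\<alpha>m > 0" "lm > 0"
    and indep: "indep_var borel X borel Y"
    and X: "distributed M lborel X (\<lambda>x. ennreal (gamma_density \<alpha>p lp x))"
    and Y: "distributed M lborel Y (\<lambda>y. ennreal (gamma_density \<alpha>m lm y))"
  shows "distributed M lborel (\<lambda>\<omega>. X \<omega> - Y \<omega>)
           (\<lambda>x. ennreal (bilateral_gamma_density \<alpha>p lp \<alpha>m lm x))"
proof -
  let ?g = "\<lambda>x. ennreal (gamma_density \<alpha>p lp x)" and ?h = "\<lambda>x. ennreal (gamma_density \<alpha>m lm x)"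
  define q where "q = (\<lambda>x. \<integral>\<^sup>+y. ?g (x - y) * ?h (- y) \<partial>lborel)"
  have Y': "distributed M lborel (\<lambda>\<omega>. - Y \<omega>) (\<lambda>y. ?h (- y))"
    using distributed_affine[OF Y, of "- 1" 0] by (simp add: divide_ennreal [of _ 1, simplified] gamma_density_nonneg pos)
  have "indep_var borel (id \<circ> X) borel (uminus \<circ> Y)"
    by (rule indep_var_compose[OF indep]) auto
  then have I: "indep_var borel X borel (\<lambda>\<omega>. - Y \<omega>)" by (simp add: o_def)
  have D: "distributed M lborel (\<lambda>\<omega>. X \<omega> - Y \<omega>) q"
    using distributed_convolution[OF I X Y'] by (simp add: q_def)
  have [measurable]: "q \<in> borel_measurable borel" unfolding q_def by measurable
  have "emeasure (density lborel q) UNIV = 1"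
    using prob_space.emeasure_space_1[OF prob_space_distr[OF distributed_measurable[OF D]]]
      distributed_distr_eq_density[OF D] by simp
  then have "(\<integral>\<^sup>+x. q x \<partial>lborel) \<noteq> \<infinity>" by (simp add: emeasure_density)
  then have fin: "AE x in lborel. q x \<noteq> \<infinity>" by (intro nn_integral_PInf_AE) auto
  have q1: "q x = (\<integral>\<^sup>+y. ?g (x + y) * ?h y \<partial>lborel)" for x
    unfolding q_def by (subst nn_integral_real_affine[where c = "- 1" and t = 0]) (auto simp: one_ennreal_def [symmetric])
  have q2: "q x = (\<integral>\<^sup>+y. ?h (- x + y) * ?g y \<partial>lborel)" for x
    unfolding q1 by (subst nn_integral_real_affine[where c = 1 and t = "- x"]) (auto simp: one_ennreal_def [symmetric] ac_simps)
  have "AE x in lborel. x \<noteq> (0::real)" by (rule AE_lborel_singleton)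
  with fin have "AE x in lborel. q x = ennreal (bilateral_gamma_density \<alpha>p lp \<alpha>m lm x)"
  proof eventually_elim
    case (elim x)
    then have fin: "q x < \<infinity>" by (simp add: less_top)
    consider "x > 0" | "x < 0" using elim by linarith
    then show ?case
    proof cases
      case 1
      then show ?thesis
        using bilateral_gamma_density_pos_eq_nn_integral[OF pos 1] fin
        by (simp add: q1 bilateral_gamma_density_def)
    next
      case 2
      then have "- x > 0" by simp
      from bilateral_gamma_density_pos_eq_nn_integral[OF pos(3,4,1,2) this] fin 2
      show ?thesis by (simp add: q2 bilateral_gamma_density_def)
    qed
  qed
  then have "density lborel q = density lborel (\<lambda>x. ennreal (bilateral_gamma_density \<alpha>p lp \<alpha>m lm x))"
    by (intro density_cong) auto
  with D show ?thesis by (simp add: distributed_def)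
qed

end

theory Submission
  imports Defs "HOL-Real_Asymp.Real_Asymp"
begin

text \<open>
  Factoring \<open>x\<^bsup>\<alpha>p - 1\<^esup>\<close> out of the integral that defines the density leaves \<open>\<Gamma>(\<alpha>m)\<close> times the expectation of
  \<open>(1 + V / (s x))\<^bsup>\<alpha>p - 1\<^esup>\<close> for \<open>V \<sim> \<Gamma>(\<alpha>m, 1)\<close> and \<open>s = lp + lm\<close>. As \<open>ln (1 + u) \<le> u\<close>, this
  power is at most \<open>e\<^bsup>V/2\<^esup>\<close> for large \<open>x\<close>, which is integrable, so the expectation tends to \<open>1\<close>
  by dominated convergence. Reflection exchanges the two tails.
\<close>

lemma integrable_gamma_density:
  assumes "\<alpha> > 0" "l > 0"
  shows "integrable lborel (gamma_density \<alpha> l)"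
  using prob_space.emeasure_space_1[OF prob_space_gamma_density[OF assms]]
  by (intro integrableI_nonneg) (auto simp: gamma_density_nonneg assms emeasure_density)

lemma integral_gamma_density:
  assumes "\<alpha> > 0" "l > 0"
  shows "(\<integral>v. gamma_density \<alpha> l v \<partial>lborel) = 1"
  using prob_space.emeasure_space_1[OF prob_space_gamma_density[OF assms]]
  by (subst integral_eq_nn_integral) (auto simp: gamma_density_nonneg assms emeasure_density)

text \<open>Since \<open>ln (1 + u)\<close> lies between \<open>0\<close> and \<open>u\<close>,
  replacing \<open>b\<close> by \<open>\<bar>b\<bar>\<close> covers exponents of both signs at once.
  This matters because \<open>\<alpha>p - 1\<close> is negative for shape parameters below
  \<open>1\<close>.\<close>

lemma one_plus_powr_le_exp:
  fixes u b :: real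
  assumes "u \<ge> 0"
  shows "(1 + u) powr b \<le> exp (\<bar>b\<bar> * u)"
proof -
  have "b * ln (1 + u) \<le> \<bar>b\<bar> * ln (1 + u)"
    using assms by (intro mult_right_mono) auto
  also have "\<dots> \<le> \<bar>b\<bar> * u"
    using assms by (intro mult_left_mono ln_add_one_self_le_self) auto
  finally show ?thesis
    using assms by (simp add: powr_def)
qed

lemma tendsto_expectation_powr_gamma_density:
  fixes a b s :: real
  assumes "a > 0" "s > 0"
  shows "((\<lambda>x. \<integral>v. gamma_density a 1 v * (1 + v / (s * x)) powr b \<partial>lborel) \<longlongrightarrow> 1) at_top"
proof -
  \<comment> \<open>For \<open>v > 0\<close> this is
    \<open>gamma_density a 1 v * exp (v / 2)\<close>: half of the exponential decay is given up, and
    \<open>2 powr a\<close> cancels the factor \<open>(1 / 2) powr a\<close> of the density with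
    rate \<open>1 / 2\<close>.\<close>
  let ?w = "\<lambda>v. 2 powr a * gamma_density a (1 / 2) v"
  have "((\<lambda>x. \<integral>v. gamma_density a 1 v * (1 + v / (s * x)) powr b \<partial>lborel)
      \<longlongrightarrow> (\<integral>v. gamma_density a 1 v \<partial>lborel)) at_top"
  proof (rule integral_dominated_convergence_at_top[where w = ?w])
    show "integrable lborel ?w"
      using integrable_gamma_density[of a "1 / 2"] assms by simp
    show "AE v in lborel. ((\<lambda>x. gamma_density a 1 v * (1 + v / (s * x)) powr b)
        \<longlongrightarrow> gamma_density a 1 v) at_top"
    proof (intro AE_I2)
      fix v :: real
      have "((\<lambda>x. v / (s * x)) \<longlongrightarrow> 0) at_top"
        using assms by real_asymp
      then have "((\<lambda>x. gamma_density a 1 v * (1 + v / (s * x)) powr b)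
          \<longlongrightarrow> gamma_density a 1 v * (1 + 0) powr b) at_top"
        by (intro tendsto_intros) auto
      then show "((\<lambda>x. gamma_density a 1 v * (1 + v / (s * x)) powr b)
          \<longlongrightarrow> gamma_density a 1 v) at_top"
        by simp
    qed
    show "\<forall>\<^sub>F x in at_top. AE v in lborel. norm (gamma_density a 1 v * (1 + v / (s * x)) powr b) \<le> ?w v"
      \<comment> \<open>Beyond this threshold \<open>\<bar>b\<bar> / (s * x)\<close> is at most
        \<open>1 / 2\<close>, whatever \<open>v\<close> is, so a single majorant serves all large
        \<open>x\<close>.\<close>
      using eventually_ge_at_top[of "2 * \<bar>b\<bar> / s"] eventually_gt_at_top[of 0]
    proof eventually_elim
      case (elim x)
      show ?case
      proof (intro AE_I2)
        fix v :: real
        show "norm (gamma_density a 1 v * (1 + v / (s * x)) powr b) \<le> ?w v"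
        proof (cases "v > 0")
          case v: True
          have "2 * \<bar>b\<bar> \<le> s * x"
            using elim assms by (simp add: field_simps)
          then have "\<bar>b\<bar> * (v / (s * x)) \<le> v / 2"
            using elim assms v by (simp add: field_simps)
          then have "(1 + v / (s * x)) powr b \<le> exp (v / 2)"
            using one_plus_powr_le_exp[of "v / (s * x)" b] elim assms v
            by (smt (verit) divide_nonneg_pos exp_le_cancel_iff mult_pos_pos)
          then have "gamma_density a 1 v * (1 + v / (s * x)) powr b
              \<le> gamma_density a 1 v * exp (v / 2)"
            using assms by (intro mult_left_mono gamma_density_nonneg) auto
          also have "\<dots> = ?w v"
            using v by (simp add: gamma_density_def powr_divide exp_add [symmetric])
          finally show ?thesis
            using assms by (simp add: gamma_density_nonneg)
        qed (simp add: gamma_density_def)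
      qed
    qed
  qed auto
  then show ?thesis
    using assms by (simp add: integral_gamma_density)
qed

text \<open>On \<open>v > 0\<close> the weight \<open>v powr (\<alpha>m - 1) * exp (- v)\<close> is
  \<open>Gamma \<alpha>m\<close> times \<open>gamma_density \<alpha>m 1 v\<close>. This cancels
  \<open>Gamma \<alpha>m\<close> in the prefactor, which is why only \<open>Gamma \<alpha>p\<close>
  survives in the tail constant.\<close>

lemma bilateral_gamma_density_pos_eq_expectation:
  assumes pos: "\<alpha>p > 0" "lp > 0" "\<alpha>m > 0" "lm > 0" and x: "x > 0"
  shows "bilateral_gamma_density_pos \<alpha>p lp \<alpha>m lm x =
    lp powr \<alpha>p * lm powr \<alpha>m / ((lp + lm) powr \<alpha>m * Gamma \<alpha>p) * x powr (\<alpha>p - 1) * exp (- lp * x)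
    * (\<integral>v. gamma_density \<alpha>m 1 v * (1 + v / ((lp + lm) * x)) powr (\<alpha>p - 1) \<partial>lborel)"
proof -
  have G: "Gamma \<alpha>m > 0"
    using pos by (simp add: Gamma_real_pos)
  have "(x + v / (lp + lm)) powr (\<alpha>p - 1)
      = x powr (\<alpha>p - 1) * (1 + v / ((lp + lm) * x)) powr (\<alpha>p - 1)" if "v > 0" for v
  proof -
    have "x + v / (lp + lm) = x * (1 + v / ((lp + lm) * x))"
      using x by (simp add: distrib_left)
    then show ?thesis
      using pos x that by (simp add: powr_mult)
  qed
  then have "(LBINT v:{0<..}. v powr (\<alpha>m - 1) * (x + v / (lp + lm)) powr (\<alpha>p - 1) * exp (- v))
      = (\<integral>v. (Gamma \<alpha>m * x powr (\<alpha>p - 1))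
          * (gamma_density \<alpha>m 1 v * (1 + v / ((lp + lm) * x)) powr (\<alpha>p - 1)) \<partial>lborel)"
    using G unfolding set_lebesgue_integral_def
    by (intro Bochner_Integration.integral_cong) (auto simp: gamma_density_def indicator_def)
  also have "\<dots> = Gamma \<alpha>m * x powr (\<alpha>p - 1)
      * (\<integral>v. gamma_density \<alpha>m 1 v * (1 + v / ((lp + lm) * x)) powr (\<alpha>p - 1) \<partial>lborel)"
    by simp
  finally show ?thesis
    using G by (simp add: bilateral_gamma_density_pos_def)
qed

lemma bilateral_gamma_density_pos_tail:
  assumes pos: "\<alpha>p > 0" "lp > 0" "\<alpha>m > 0" "lm > 0"
    and C: "C = lp powr \<alpha>p * lm powr \<alpha>m / ((lp + lm) powr \<alpha>m * Gamma \<alpha>p)"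
  shows "((\<lambda>x. bilateral_gamma_density_pos \<alpha>p lp \<alpha>m lm x
      / (C * x powr (\<alpha>p - 1) * exp (- lp * x))) \<longlongrightarrow> 1) at_top"
proof -
  have C0: "C > 0"
    using pos by (simp add: C Gamma_real_pos)
  \<comment> \<open>The quotient is exactly the expectation for every \<open>x > 0\<close>, so its
    limit is already known.\<close>
  have "\<forall>\<^sub>F x in at_top. (\<integral>v. gamma_density \<alpha>m 1 v * (1 + v / ((lp + lm) * x)) powr (\<alpha>p - 1) \<partial>lborel)
      = bilateral_gamma_density_pos \<alpha>p lp \<alpha>m lm x / (C * x powr (\<alpha>p - 1) * exp (- lp * x))"
    using eventually_gt_at_top[of 0]
  proof eventually_elim
    case (elim x)
    then show ?case
      using C0 by (simp add: bilateral_gamma_density_pos_eq_expectation[OF pos elim] C [symmetric])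
  qed
  then show ?thesis
    using tendsto_expectation_powr_gamma_density[of \<alpha>m "lp + lm" "\<alpha>p - 1"] pos
    by (auto elim: Lim_transform_eventually)
qed

text \<open>Taking logarithms splits \<open>ln (g x)\<close> into a term tending to
  \<open>ln 1 = 0\<close> and \<open>ln C + p * ln x - l * x\<close>. After division by
  \<open>x\<close> only the linear term remains.\<close>

lemma tendsto_ln_div_of_powr_exp_tail:
  fixes g :: "real \<Rightarrow> real"
  assumes lim: "((\<lambda>x. g x / (C * x powr p * exp (- l * x))) \<longlongrightarrow> 1) at_top" and C: "C > 0"
  shows "((\<lambda>x. ln (g x) / x) \<longlongrightarrow> - l) at_top"
proof -
  let ?h = "\<lambda>x. C * x powr p * exp (- l * x)"
  have "((\<lambda>x. ln (g x / ?h x)) \<longlongrightarrow> ln 1) at_top"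
    by (intro tendsto_ln lim) auto
  then have "((\<lambda>x. ln (g x / ?h x) / x) \<longlongrightarrow> 0) at_top"
    by (intro tendsto_divide_0[OF _ filterlim_at_top_imp_at_infinity[OF filterlim_ident]])
  moreover have "((\<lambda>x. (ln C + p * ln x - l * x) / x) \<longlongrightarrow> - l) at_top"
    by real_asymp
  ultimately have "((\<lambda>x. ln (g x / ?h x) / x + (ln C + p * ln x - l * x) / x) \<longlongrightarrow> 0 + - l) at_top"
    by (rule tendsto_add)
  moreover have "\<forall>\<^sub>F x in at_top. ln (g x / ?h x) / x + (ln C + p * ln x - l * x) / x = ln (g x) / x"
    \<comment> \<open>A quotient with limit \<open>1\<close> is eventually positive, which forces
      \<open>g x > 0\<close>, so that the logarithm of the quotient splits.\<close>
    using order_tendstoD(1)[OF lim zero_less_one] eventually_gt_at_top[of 0]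
  proof eventually_elim
    case (elim x)
    then have h: "?h x > 0"
      using C by simp
    then have "g x > 0"
      using elim by (simp add: zero_less_divide_iff)
    then show ?case
      using h elim C by (simp add: ln_div ln_mult ln_powr field_simps)
  qed
  ultimately show ?thesis
    by (auto elim: Lim_transform_eventually)
qed

theorem mainTheorem4:
  fixes \<alpha>p lp \<alpha>m lm C3 C4 :: real and f :: "real \<Rightarrow> real"
  assumes "\<alpha>p > 0" and "lp > 0" and "\<alpha>m > 0" and "lm > 0"
    and f: "f = bilateral_gamma_density \<alpha>p lp \<alpha>m lm"
    and C3: "C3 = lp powr \<alpha>p * lm powr \<alpha>m / ((lp + lm) powr \<alpha>m * Gamma \<alpha>p)"
    and C4: "C4 = lp powr \<alpha>p * lm powr \<alpha>m / ((lp + lm) powr \<alpha>p * Gamma \<alpha>m)"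
  shows "C3 > 0 \<and> C4 > 0
    \<and> f \<sim>[at_top] (\<lambda>x. C3 * x powr (\<alpha>p - 1) * exp (- lp * x))
    \<and> f \<sim>[at_bot] (\<lambda>x. C4 * \<bar>x\<bar> powr (\<alpha>m - 1) * exp (- lm * \<bar>x\<bar>))
    \<and> ((\<lambda>x. ln (f x) / x) \<longlongrightarrow> - lp) at_top
    \<and> ((\<lambda>x. ln (f x) / x) \<longlongrightarrow> lm) at_bot"
proof -
  have C3_pos: "C3 > 0" and C4_pos: "C4 > 0"
    using assms by (simp_all add: Gamma_real_pos)
  have C4': "C4 = lm powr \<alpha>m * lp powr \<alpha>p / ((lm + lp) powr \<alpha>p * Gamma \<alpha>m)"
    by (simp add: C4 ac_simps)
  have right: "((\<lambda>x. f x / (C3 * x powr (\<alpha>p - 1) * exp (- lp * x))) \<longlongrightarrow> 1) at_top"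
    by (rule Lim_transform_eventually[OF bilateral_gamma_density_pos_tail[OF assms(1-4) C3]])
      (use eventually_gt_at_top[of 0] in eventually_elim, simp add: f bilateral_gamma_density_def)
  \<comment> \<open>For \<open>x > 0\<close> the value \<open>f (- x)\<close> is the one-sided
    density with the plus and minus parameters exchanged, so the same tail result applies;
    \<open>C4'\<close> is \<open>C4\<close> with its factors in that order.\<close>
  have left: "((\<lambda>x. f (- x) / (C4 * x powr (\<alpha>m - 1) * exp (- lm * x))) \<longlongrightarrow> 1) at_top"
    by (rule Lim_transform_eventually[OF bilateral_gamma_density_pos_tail[OF assms(3,4,1,2) C4']])
      (use eventually_gt_at_top[of 0] in eventually_elim, simp add: f bilateral_gamma_density_def)
  have "f \<sim>[at_top] (\<lambda>x. C3 * x powr (\<alpha>p - 1) * exp (- lp * x))"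
    by (rule asymp_equivI'[OF right])
  moreover have "f \<sim>[at_bot] (\<lambda>x. C4 * \<bar>x\<bar> powr (\<alpha>m - 1) * exp (- lm * \<bar>x\<bar>))"
  proof (rule asymp_equivI', subst filterlim_at_bot_mirror)
    show "((\<lambda>x. f (- x) / (C4 * \<bar>- x\<bar> powr (\<alpha>m - 1) * exp (- lm * \<bar>- x\<bar>))) \<longlongrightarrow> 1) at_top"
      by (rule Lim_transform_eventually[OF left])
        (use eventually_gt_at_top[of 0] in eventually_elim, simp)
  qed
  moreover have "((\<lambda>x. ln (f x) / x) \<longlongrightarrow> - lp) at_top"
    by (rule tendsto_ln_div_of_powr_exp_tail[OF right C3_pos])
  moreover have "((\<lambda>x. ln (f x) / x) \<longlongrightarrow> lm) at_bot"
    \<comment> \<open>The limit of \<open>ln (f (- x)) / x\<close> is \<open>- lm\<close>; under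
      reflection the denominator becomes \<open>- x\<close>, which reverses the sign.\<close>
    using tendsto_minus[OF tendsto_ln_div_of_powr_exp_tail[OF left C4_pos]]
    by (subst filterlim_at_bot_mirror) simp
  ultimately show ?thesis
    using C3_pos C4_pos by blast
qed

end
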